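(* Let $r\ge1$ and $m\ge2$ be integers, let $C_m^r$ be the homocyclic group of exponent $m$ and rank $r$, and let $S=\{s_1,\dots,s_r\}$ be an $r$-element generating subset of $C_m^r$, ordered as $s_1<s_2<\dots<s_r$. Every element of $C_m^r$ has a unique representation $x_1s_1+\dots+x_rs_r$ with integers $0\le x_i\le m-1$; order $C_m^r$ lexicographically, i.e. $x_1s_1+\dots+x_rs_r$ precedes $y_1s_1+\dots+y_rs_r$ if at the first index $i$ with $x_i\ne y_i$ one has $x_i<y_i$. For an integer $0\le n\le m^r$ let $I_n$ denote the set of the $n$ smallest elements of $C_m^r$ in this order. Then $$\partial_S(I_n)=m^r\,\omega_m(n/m^r).$$
   Context: For subsets $S,A$ of a finite abelian group $G$, $\partial_S(A):=|\{(a,s)\in A\times S:\ a+s\notin A\}|$. For real $x$, $\|x\|$ denotes the distance from $x$ to the nearest integer, and for real $\alpha$, $\|x\|_\alpha:=\min\{\|x\|,\alpha\}$. For an integer $m\ge2$, $\omega_m(x):=\sum_{k=0}^\infty m^{-k}\|m^kx\|_{1/m}$ (so $\omega_2$ is the Takagi function). *)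

theory Defs
  imports Complex_Main "HOL-Algebra.Algebra"
begin

definition homocyclic_group :: "('a, 'b) monoid_scheme \<Rightarrow> nat \<Rightarrow> nat \<Rightarrow> bool" where
  "homocyclic_group G m r \<longleftrightarrow>
     comm_group G \<and> G \<cong> product_group {1..r} (\<lambda>_. integer_mod_group m)"

definition edge_boundary :: "('a, 'b) monoid_scheme \<Rightarrow> 'a set \<Rightarrow> 'a set \<Rightarrow> nat" where
  "edge_boundary G S A = card {(a, s) \<in> A \<times> S. a \<otimes>\<^bsub>G\<^esub> s \<notin> A}"

definition dist_nearest_int :: "real \<Rightarrow> real" where
  "dist_nearest_int x = \<bar>x - of_int (round x)\<bar>"

definition trunc_dist_nearest_int :: "real \<Rightarrow> real \<Rightarrow> real" where
  "trunc_dist_nearest_int \<alpha> x = min (dist_nearest_int x) \<alpha>"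

definition takagi :: "nat \<Rightarrow> real \<Rightarrow> real" where
  "takagi m x = suminf (\<lambda>k. trunc_dist_nearest_int (1 / real m) (real m ^ k * x) / real m ^ k)"

lemma summable_takagi:
  assumes "m \<ge> 2"
  shows "summable (\<lambda>k. trunc_dist_nearest_int (1 / real m) (real m ^ k * x) / real m ^ k)"
proof (rule summable_comparison_test')
  show "summable (\<lambda>k. (1 / real m) ^ k)"
    using assms by (intro summable_geometric) simp
next
  fix k :: nat
  have "0 \<le> trunc_dist_nearest_int (1 / real m) y" "trunc_dist_nearest_int (1 / real m) y \<le> 1" for y
    using assms by (auto simp: trunc_dist_nearest_int_def dist_nearest_int_def min_le_iff_disj)
  then show "norm (trunc_dist_nearest_int (1 / real m) (real m ^ k * x) / real m ^ k) \<le> (1 / real m) ^ k"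
    by (simp add: power_one_over divide_right_mono)
qed

definition digit_vectors :: "nat \<Rightarrow> nat \<Rightarrow> (nat \<Rightarrow> nat) set" where
  "digit_vectors m r = {1..r} \<rightarrow>\<^sub>E {0..m - 1}"

text \<open>The combination $x_1 s_1 + \dots + x_r s_r$, in the multiplicative notation of the library.\<close>

definition digit_comb :: "('a, 'b) monoid_scheme \<Rightarrow> nat \<Rightarrow> (nat \<Rightarrow> 'a) \<Rightarrow> (nat \<Rightarrow> nat) \<Rightarrow> 'a" where
  "digit_comb G r s x = (\<Otimes>\<^bsub>G\<^esub>i\<in>{1..r}. s i [^]\<^bsub>G\<^esub> x i)"

definition lex_precedes ::
  "('a, 'b) monoid_scheme \<Rightarrow> nat \<Rightarrow> nat \<Rightarrow> (nat \<Rightarrow> 'a) \<Rightarrow> 'a \<Rightarrow> 'a \<Rightarrow> bool" where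
  "lex_precedes G m r s g h \<longleftrightarrow>
     (\<exists>x\<in>digit_vectors m r. \<exists>y\<in>digit_vectors m r.
        g = digit_comb G r s x \<and> h = digit_comb G r s y \<and>
        (\<exists>i\<in>{1..r}. (\<forall>j\<in>{1..<i}. x j = y j) \<and> x i < y i))"

text \<open>An element is among the \<open>n\<close> smallest ones iff fewer than \<open>n\<close> elements precede it.\<close>

definition initial_segment ::
  "('a, 'b) monoid_scheme \<Rightarrow> nat \<Rightarrow> nat \<Rightarrow> (nat \<Rightarrow> 'a) \<Rightarrow> nat \<Rightarrow> 'a set" where
  "initial_segment G m r s n =
     {g \<in> carrier G. card {h \<in> carrier G. lex_precedes G m r s h g} < n}"

lemma homocyclic_group_card:
  assumes "homocyclic_group G m r" "m \<ge> 2"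
  shows "card (carrier G) = m ^ r"
proof -
  have "card (carrier G) = card (carrier (product_group {1..r} (\<lambda>_. integer_mod_group m)))"
    using assms(1) by (intro iso_same_card) (simp add: homocyclic_group_def)
  also have "\<dots> = m ^ r"
    using assms by (simp add: carrier_integer_mod_group card_PiE)
  finally show ?thesis .
qed

lemma homocyclic_group_pow_exponent:
  assumes "homocyclic_group G m r" "m \<ge> 2" "g \<in> carrier G"
  shows "g [^]\<^bsub>G\<^esub> m = \<one>\<^bsub>G\<^esub>"
proof -
  let ?P = "product_group {1..r} (\<lambda>_. integer_mod_group m)"
  interpret G: comm_group G using assms by (simp add: homocyclic_group_def)
  interpret P: group ?P by simp
  obtain f where f: "f \<in> iso G ?P"
    using assms by (auto simp: homocyclic_group_def is_iso_def)
  then have hom: "f \<in> hom G ?P" and inj: "inj_on f (carrier G)"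
    by (auto simp: iso_def bij_betw_def)
  interpret f: group_hom G ?P f
    by unfold_locales (rule hom)
  have fg: "f g \<in> carrier ?P" using assms(3) by (rule f.hom_closed)
  have pow: "f g [^]\<^bsub>?P\<^esub> k = (\<lambda>i\<in>{1..r}. (int k * f g i) mod int m)" for k :: nat
  proof (induction k)
    case 0
    then show ?case by (simp add: P.nat_pow_0)
  next
    case (Suc k)
    then show ?case
      by (auto simp: P.nat_pow_Suc fun_eq_iff mod_add_left_eq mod_add_right_eq algebra_simps)
  qed
  have "f (g [^]\<^bsub>G\<^esub> m) = f g [^]\<^bsub>?P\<^esub> m"
    using assms(3) by (rule f.hom_nat_pow)
  also have "\<dots> = \<one>\<^bsub>?P\<^esub>"
    unfolding pow by simp
  also have "\<dots> = f \<one>\<^bsub>G\<^esub>" by simp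
  finally show ?thesis
    using inj_onD[OF inj] assms(3) by (meson G.nat_pow_closed G.one_closed)
qed

lemma unique_digit_representation:
  assumes hom: "homocyclic_group G m r" and m: "m \<ge> 2"
    and S: "S \<subseteq> carrier G" and gen: "generate G S = carrier G"
    and s: "bij_betw s {1..r} S"
    and g: "g \<in> carrier G"
  shows "\<exists>!x. x \<in> digit_vectors m r \<and> g = digit_comb G r s x"
proof -
  interpret G: comm_group G using hom by (simp add: homocyclic_group_def)
  let ?c = "digit_comb G r s" and ?D = "digit_vectors m r"
  have sG: "s i \<in> carrier G" if "i \<in> {1..r}" for i
    using that s S by (auto simp: bij_betw_def)
  have pow_mod: "h [^]\<^bsub>G\<^esub> (k mod m) = h [^]\<^bsub>G\<^esub> k" if h: "h \<in> carrier G" for h k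
  proof -
    have "h [^]\<^bsub>G\<^esub> k = h [^]\<^bsub>G\<^esub> (m * (k div m) + k mod m)" by simp
    also have "\<dots> = (h [^]\<^bsub>G\<^esub> m) [^]\<^bsub>G\<^esub> (k div m) \<otimes>\<^bsub>G\<^esub> h [^]\<^bsub>G\<^esub> (k mod m)"
      using h by (simp only: G.nat_pow_mult[symmetric] G.nat_pow_pow)
    finally show ?thesis
      using h homocyclic_group_pow_exponent[OF hom m h] by simp
  qed
  have red: "(\<lambda>i\<in>{1..r}. x i mod m) \<in> ?D" for x :: "nat \<Rightarrow> nat"
  proof -
    have "a mod m \<le> m - 1" for a
      using mod_less_divisor[of m a] m by linarith
    then show ?thesis by (auto simp: digit_vectors_def)
  qed
  have c_red: "?c (\<lambda>i\<in>{1..r}. x i mod m) = ?c x" for x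
    unfolding digit_comb_def by (rule G.finprod_cong') (auto simp: sG pow_mod)
  have c_in: "?c x \<in> ?c ` ?D" for x
    using red[of x] c_red[of x] by (metis image_eqI)
  have c_pow: "s i [^]\<^bsub>G\<^esub> k \<in> ?c ` ?D" if i: "i \<in> {1..r}" for i and k :: nat
  proof -
    have "?c (\<lambda>j. if j = i then k else 0)
        = (\<Otimes>\<^bsub>G\<^esub>j\<in>{1..r}. if i = j then s j [^]\<^bsub>G\<^esub> k else \<one>\<^bsub>G\<^esub>)"
      unfolding digit_comb_def by (rule G.finprod_cong') (auto simp: sG)
    also have "\<dots> = s i [^]\<^bsub>G\<^esub> k"
      using i sG by (intro G.finprod_singleton) auto
    finally show ?thesis using c_in by metis
  qed
  have "g' \<in> ?c ` ?D" if "g' \<in> generate G S" for g'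
    using that
  proof (induction rule: generate.induct)
    case one
    have "?c (\<lambda>_. 0) = \<one>\<^bsub>G\<^esub>" by (simp add: digit_comb_def)
    then show ?case using c_in by metis
  next
    case (incl h)
    then obtain i where i: "i \<in> {1..r}" "h = s i" using s by (auto simp: bij_betw_def)
    then show ?case using c_pow[of i 1] sG by simp
  next
    case (inv h)
    then obtain i where i: "i \<in> {1..r}" "h = s i" using s by (auto simp: bij_betw_def)
    have "s i [^]\<^bsub>G\<^esub> (m - 1) \<otimes>\<^bsub>G\<^esub> s i = s i [^]\<^bsub>G\<^esub> (Suc (m - 1))"
      by (simp add: G.nat_pow_Suc)
    also have "\<dots> = \<one>\<^bsub>G\<^esub>"
      using m homocyclic_group_pow_exponent[OF hom m sG[OF i(1)]] by simp
    finally have "inv\<^bsub>G\<^esub> (s i) = s i [^]\<^bsub>G\<^esub> (m - 1)"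
      using sG[OF i(1)] by (intro G.inv_equality) auto
    then show ?case using c_pow[OF i(1)] i(2) by simp
  next
    case (eng h1 h2)
    then obtain x y where xy: "h1 = ?c x" "h2 = ?c y" by blast
    have "h1 \<otimes>\<^bsub>G\<^esub> h2 = (\<Otimes>\<^bsub>G\<^esub>i\<in>{1..r}. s i [^]\<^bsub>G\<^esub> x i \<otimes>\<^bsub>G\<^esub> s i [^]\<^bsub>G\<^esub> y i)"
      unfolding xy digit_comb_def by (rule G.finprod_multf[symmetric]) (auto simp: sG)
    also have "\<dots> = ?c (\<lambda>i. x i + y i)"
      unfolding digit_comb_def by (rule G.finprod_cong') (auto simp: sG G.nat_pow_mult)
    finally show ?case using c_in by metis
  qed
  then have "carrier G \<subseteq> ?c ` ?D" using gen by auto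
  moreover have "?c ` ?D \<subseteq> carrier G"
    by (auto simp: digit_comb_def sG intro!: G.finprod_closed)
  ultimately have img: "?c ` ?D = carrier G" by blast
  have fin: "finite ?D" by (auto simp: digit_vectors_def intro: finite_PiE)
  have "card ?D = m ^ r" using m by (simp add: digit_vectors_def card_PiE)
  then have "inj_on ?c ?D"
    using homocyclic_group_card[OF hom m] img fin by (simp add: eq_card_imp_inj_on)
  then show ?thesis
    using img g by (auto simp: inj_on_def)
qed

end

theory Submission
  imports Defs
begin

text \<open>Reading the coordinates of an element as base-\<open>m\<close> digits identifies the group with
  \<open>{0..<m ^ r}\<close>, the lexicographic order with the usual one, and \<open>I\<^sub>n\<close> with \<open>{0..<n}\<close>. Adding
  \<open>s\<^sub>i\<close> increments the digit of weight \<open>q = m ^ (r - i)\<close> cyclically. It leaves \<open>{0..<n}\<close> iff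
  the digit is not \<open>m - 1\<close> and \<open>n \<le> v + q\<close>, which happens for exactly
  \<open>min {t, m q - t, q}\<close> numbers \<open>v < n\<close>, where \<open>t = n mod (m q)\<close>. This is \<open>m ^ r\<close> times the
  summand with index \<open>i - 1\<close> of \<open>\<omega>\<^sub>m (n / m ^ r)\<close>; the summands from index \<open>r\<close> on vanish.\<close>

section \<open>Base-\<open>m\<close> values of digit vectors\<close>

text \<open>Horner's scheme with index 1 as the most significant digit, because the lexicographic
  order compares index 1 first; index \<open>i\<close> thus has weight
  \<open>m ^ (r - i)\<close>.\<close>

primrec digit_value :: "nat \<Rightarrow> nat \<Rightarrow> (nat \<Rightarrow> nat) \<Rightarrow> nat" where
  "digit_value m 0 x = 0"
| "digit_value m (Suc r) x = m * digit_value m r x + x (Suc r)"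

lemma digit_value_less:
  assumes "\<And>i. i \<in> {1..r} \<Longrightarrow> x i < m"
  shows "digit_value m r x < m ^ r"
  using assms
proof (induction r)
  case (Suc r)
  have "digit_value m r x < m ^ r" "x (Suc r) < m" using Suc by auto
  then have "m * Suc (digit_value m r x) \<le> m * m ^ r" by (intro mult_le_mono2) simp
  with \<open>x (Suc r) < m\<close> show ?case by simp
qed simp

text \<open>Dividing by \<open>m\<close> drops the last digit, since that digit is below
  \<open>m\<close>; every earlier index therefore reduces to the vector shortened by one.\<close>

lemma digit_value_digit:
  assumes "\<And>i. i \<in> {1..r} \<Longrightarrow> x i < m" and "i \<in> {1..r}"
  shows "digit_value m r x div m ^ (r - i) mod m = x i"
  using assms
proof (induction r)
  case (Suc r)
  have m: "x (Suc r) < m" using Suc.prems by auto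
  show ?case
  proof (cases "i = Suc r")
    case False
    then have i: "i \<in> {1..r}" using Suc.prems by auto
    then have e: "Suc r - i = Suc (r - i)" by auto
    have "digit_value m (Suc r) x div m ^ (Suc r - i) = digit_value m r x div m ^ (r - i)"
      unfolding e power_Suc div_mult2_eq using m by simp
    then show ?thesis using Suc.IH[OF _ i] Suc.prems by auto
  qed (use m in simp)
qed simp

text \<open>The value is linear in each digit. The old contribution stands on the left so that no
  subtraction of naturals occurs.\<close>

lemma digit_value_upd:
  assumes "i \<in> {1..r}"
  shows "digit_value m r (x(i := d)) + x i * m ^ (r - i) = digit_value m r x + d * m ^ (r - i)"
  using assms
proof (induction r)
  case (Suc r)
  have out: "digit_value m k (x(Suc r := d)) = digit_value m k x" if "k \<le> r" for k
    using that by (induction k) auto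
  show ?case
  proof (cases "i = Suc r")
    case True
    then show ?thesis using out[of r] by (simp del: fun_upd_apply add: fun_upd_same)
  next
    case False
    then have i: "i \<in> {1..r}" using Suc.prems by auto
    then have "Suc r - i = Suc (r - i)" by auto
    then show ?thesis
      using False arg_cong[OF Suc.IH[OF i], of "\<lambda>z. m * z"]
      by (simp del: fun_upd_apply add: fun_upd_other algebra_simps)
  qed
qed simp

text \<open>A lead of at least 1 in the leading part grows to at least \<open>m\<close> when a digit
  is appended, so no later digit below \<open>m\<close> can make up for it.\<close>

lemma digit_value_less_iff_lex:
  assumes "\<And>i. i \<in> {1..r} \<Longrightarrow> x i < m" "\<And>i. i \<in> {1..r} \<Longrightarrow> y i < m"
  shows "digit_value m r x < digit_value m r y \<longleftrightarrow>
    (\<exists>i\<in>{1..r}. (\<forall>j\<in>{1..<i}. x j = y j) \<and> x i < y i)" (is "?L \<longleftrightarrow> ?R")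
proof -
  have less: "digit_value m r x < digit_value m r y"
    if "\<And>i. i \<in> {1..r} \<Longrightarrow> x i < m" "\<And>i. i \<in> {1..r} \<Longrightarrow> y i < m"
      "i \<in> {1..r}" "\<And>j. j \<in> {1..<i} \<Longrightarrow> x j = y j" "x i < y i" for x y :: "nat \<Rightarrow> nat" and i
    using that
  proof (induction r)
    case (Suc r)
    show ?case
    proof (cases "i = Suc r")
      case True
      have "digit_value m k x = digit_value m k y" if "k \<le> r" for k
        using that Suc.prems(4) True by (induction k) auto
      then show ?thesis using True Suc.prems by simp
    next
      case False
      then have "digit_value m r x < digit_value m r y" using Suc by auto
      then have "m * Suc (digit_value m r x) \<le> m * digit_value m r y" by (intro mult_le_mono2) simp
      moreover have "x (Suc r) < m" using Suc.prems by auto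
      ultimately show ?thesis by simp
    qed
  qed simp
  show ?thesis
  proof
    assume ?R
    then show ?L using less assms by blast
  next
    assume L: ?L
    have "\<exists>i. i \<in> {1..r} \<and> x i \<noteq> y i"
    proof (rule ccontr)
      assume "\<not> ?thesis"
      then have "digit_value m k x = digit_value m k y" if "k \<le> r" for k
        using that by (induction k) auto
      then show False using L by simp
    qed
    from this[THEN exists_least_iff[THEN iffD1]]
    obtain i where i: "i \<in> {1..r}" "x i \<noteq> y i"
      and min: "\<And>j. j < i \<Longrightarrow> \<not> (j \<in> {1..r} \<and> x j \<noteq> y j)"
      by blast
    have eq: "x j = y j" if "j \<in> {1..<i}" for j using min[of j] that i by auto
    \<comment> \<open>At the first index of difference, the opposite inequality would give the
      opposite order of the values, by \<open>less\<close> with \<open>x\<close> and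
      \<open>y\<close> exchanged.\<close>
    have "\<not> y i < x i" using less[of y x i] assms i eq L by force
    then show ?R using i eq by (metis linorder_neqE_nat)
  qed
qed

lemma digit_vectors_less:
  "\<lbrakk>m \<ge> 2; x \<in> digit_vectors m r; i \<in> {1..r}\<rbrakk> \<Longrightarrow> x i < m"
  by (fastforce simp: digit_vectors_def PiE_def Pi_def)

text \<open>The digits can be recovered from the value, which gives injectivity; surjectivity
  follows because both sides have \<open>m ^ r\<close> elements.\<close>

lemma bij_betw_digit_value:
  assumes m: "m \<ge> 2"
  shows "bij_betw (digit_value m r) (digit_vectors m r) {..<m ^ r}"
proof -
  note less = digit_vectors_less[OF m]
  have inj: "inj_on (digit_value m r) (digit_vectors m r)"
  proof (rule inj_onI)
    fix x y assume xy: "x \<in> digit_vectors m r" "y \<in> digit_vectors m r"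
      "digit_value m r x = digit_value m r y"
    then have eq: "x i = y i" if "i \<in> {1..r}" for i
      using digit_value_digit[of r x m i] digit_value_digit[of r y m i] less that by auto
    show "x = y"
      by (rule PiE_ext[OF xy(1,2)[unfolded digit_vectors_def] eq])
  qed
  have "digit_value m r ` digit_vectors m r \<subseteq> {..<m ^ r}"
    using less by (auto intro!: digit_value_less)
  moreover have "card (digit_vectors m r) = m ^ r"
    using m by (simp add: digit_vectors_def card_PiE)
  ultimately have "digit_value m r ` digit_vectors m r = {..<m ^ r}"
    using inj by (intro card_subset_eq) (auto simp: card_image)
  with inj show ?thesis by (simp add: bij_betw_def)
qed

section \<open>The group and its initial segments in coordinates\<close>

lemma bij_betw_digit_comb:
  assumes "homocyclic_group G m r" "m \<ge> 2" "S \<subseteq> carrier G" "generate G S = carrier G"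
    "bij_betw s {1..r} S"
  shows "bij_betw (digit_comb G r s) (digit_vectors m r) (carrier G)"
proof -
  interpret G: comm_group G using assms by (simp add: homocyclic_group_def)
  have s: "s i \<in> carrier G" if "i \<in> {1..r}" for i
    using that assms by (auto simp: bij_betw_def)
  have closed: "digit_comb G r s x \<in> carrier G" for x
    by (auto simp: digit_comb_def s intro!: G.finprod_closed)
  note ex1 = unique_digit_representation[OF assms]
  show ?thesis
    unfolding bij_betw_def
  proof
    show "inj_on (digit_comb G r s) (digit_vectors m r)"
      using ex1[OF closed] by (intro inj_onI) blast
    show "digit_comb G r s ` digit_vectors m r = carrier G"
      using ex1 closed by blast
  qed
qed

text \<open>Only the factor at index \<open>i\<close> changes, and its exponent may be reduced
  modulo \<open>m\<close> because every element has exponent dividing \<open>m\<close>.\<close>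

lemma digit_comb_mult_generator:
  assumes "homocyclic_group G m r" "m \<ge> 2" "\<And>i. i \<in> {1..r} \<Longrightarrow> s i \<in> carrier G" "i \<in> {1..r}"
  shows "digit_comb G r s x \<otimes>\<^bsub>G\<^esub> s i = digit_comb G r s (x(i := Suc (x i) mod m))"
proof -
  interpret G: comm_group G using assms by (simp add: homocyclic_group_def)
  note s = assms(3)
  have "s i [^]\<^bsub>G\<^esub> (Suc (x i)) = s i [^]\<^bsub>G\<^esub> (m * (Suc (x i) div m) + Suc (x i) mod m)" by simp
  also have "\<dots> = (s i [^]\<^bsub>G\<^esub> m) [^]\<^bsub>G\<^esub> (Suc (x i) div m) \<otimes>\<^bsub>G\<^esub> s i [^]\<^bsub>G\<^esub> (Suc (x i) mod m)"
    using s[OF assms(4)] by (simp only: G.nat_pow_mult[symmetric] G.nat_pow_pow)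
  also have "\<dots> = s i [^]\<^bsub>G\<^esub> (Suc (x i) mod m)"
    using s[OF assms(4)] homocyclic_group_pow_exponent[OF assms(1,2) s[OF assms(4)]] by simp
  finally have pow: "s i [^]\<^bsub>G\<^esub> (Suc (x i) mod m) = s i [^]\<^bsub>G\<^esub> x i \<otimes>\<^bsub>G\<^esub> s i"
    by simp
  have split: "digit_comb G r s z = s i [^]\<^bsub>G\<^esub> z i \<otimes>\<^bsub>G\<^esub> (\<Otimes>\<^bsub>G\<^esub>j\<in>{1..r}-{i}. s j [^]\<^bsub>G\<^esub> z j)" for z
  proof -
    have "digit_comb G r s z = (\<Otimes>\<^bsub>G\<^esub>j\<in>insert i ({1..r}-{i}). s j [^]\<^bsub>G\<^esub> z j)"
      unfolding digit_comb_def using assms(4) by (simp add: insert_absorb)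
    also have "\<dots> = s i [^]\<^bsub>G\<^esub> z i \<otimes>\<^bsub>G\<^esub> (\<Otimes>\<^bsub>G\<^esub>j\<in>{1..r}-{i}. s j [^]\<^bsub>G\<^esub> z j)"
      using s assms(4) by (intro G.finprod_insert) auto
    finally show ?thesis .
  qed
  let ?P = "\<lambda>z. \<Otimes>\<^bsub>G\<^esub>j\<in>{1..r}-{i}. s j [^]\<^bsub>G\<^esub> z j"
  have rest: "?P (x(i := Suc (x i) mod m)) = ?P x"
    using s by (intro G.finprod_cong') auto
  have "?P x \<in> carrier G" using s by (auto intro!: G.finprod_closed)
  then show ?thesis
    unfolding split rest using s[OF assms(4)] by (simp add: pow G.m_ac)
qed

text \<open>The element with digit vector \<open>x\<close> has exactly
  \<open>digit_value m r x\<close> predecessors, since the values fill \<open>{..<m ^ r}\<close>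
  without gaps.\<close>

lemma initial_segment_digit_value:
  assumes "homocyclic_group G m r" "m \<ge> 2" "S \<subseteq> carrier G" "generate G S = carrier G"
    "bij_betw s {1..r} S"
  shows "initial_segment G m r s n
    = digit_comb G r s ` {x \<in> digit_vectors m r. digit_value m r x < n}"
proof -
  let ?c = "digit_comb G r s" and ?D = "digit_vectors m r" and ?v = "digit_value m r"
  note bij = bij_betw_digit_comb[OF assms]
  then have inj: "inj_on ?c ?D" and img: "?c ` ?D = carrier G" by (auto simp: bij_betw_def)
  note vbij = bij_betw_digit_value[OF assms(2), of r]
  have lex: "lex_precedes G m r s (?c y) (?c x) \<longleftrightarrow> ?v y < ?v x" if "x \<in> ?D" "y \<in> ?D" for x y
  proof -
    have "?v y < ?v x \<longleftrightarrow> (\<exists>i\<in>{1..r}. (\<forall>j\<in>{1..<i}. y j = x j) \<and> y i < x i)"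
      using that digit_vectors_less[OF assms(2)] by (intro digit_value_less_iff_lex) auto
    moreover have "lex_precedes G m r s (?c y) (?c x) \<longleftrightarrow>
        (\<exists>i\<in>{1..r}. (\<forall>j\<in>{1..<i}. y j = x j) \<and> y i < x i)"
    proof
      assume "lex_precedes G m r s (?c y) (?c x)"
      then obtain y' x' where y': "y' \<in> ?D" "?c y = ?c y'" and x': "x' \<in> ?D" "?c x = ?c x'"
        and ex: "\<exists>i\<in>{1..r}. (\<forall>j\<in>{1..<i}. y' j = x' j) \<and> y' i < x' i"
        unfolding lex_precedes_def by blast
      \<comment> \<open>\<open>lex_precedes\<close> only asserts that some representations compare;
        by uniqueness they are the given ones.\<close>
      have "y' = y" "x' = x" using x' y' that inj_on_eq_iff[OF inj] by simp_all
      with ex show "\<exists>i\<in>{1..r}. (\<forall>j\<in>{1..<i}. y j = x j) \<and> y i < x i" by simp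
    qed (use that in \<open>unfold lex_precedes_def, blast\<close>)
    ultimately show ?thesis by simp
  qed
  have card: "card {h \<in> carrier G. lex_precedes G m r s h (?c x)} = ?v x" if x: "x \<in> ?D" for x
  proof -
    let ?B = "{y \<in> ?D. ?v y < ?v x}"
    have "{h \<in> carrier G. lex_precedes G m r s h (?c x)} = ?c ` ?B"
      unfolding img[symmetric] using lex[OF x] by blast
    moreover have "card (?c ` ?B) = card ?B"
      by (intro card_image inj_on_subset[OF inj]) auto
    moreover have "card (?v ` ?B) = card ?B"
      by (intro card_image inj_on_subset[OF bij_betw_imp_inj_on[OF vbij]]) auto
    moreover have "?v ` ?B = {w \<in> {..<m ^ r}. w < ?v x}"
      unfolding bij_betw_imp_surj_on[OF vbij, symmetric] by blast
    moreover have "{w \<in> {..<m ^ r}. w < ?v x} = {..<?v x}"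
      using bij_betw_apply[OF vbij x] by auto
    ultimately show ?thesis by (simp only: card_lessThan)
  qed
  show ?thesis
    unfolding initial_segment_def using card[unfolded img[symmetric]] by (auto simp flip: img)
qed

section \<open>Counting the boundary in one direction\<close>

text \<open>Cut the naturals into blocks of length \<open>M = m * q\<close> and write
  \<open>n = a * M + t\<close>. The excluded digit \<open>m - 1\<close> occupies the last
  \<open>q\<close> places of each block, so the numbers counted form one interval inside block
  \<open>a\<close>; as \<open>2 * q <= M\<close>, its length is the stated minimum.\<close>

lemma card_range_digit_ne:
  fixes m q n :: nat
  assumes m: "m \<ge> 2" and q: "q > 0"
  defines "t \<equiv> n mod (m * q)"
  shows "card {v. v < n \<and> n \<le> v + q \<and> v div q mod m \<noteq> m - 1} = min (min t (m * q - t)) q"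
proof -
  define M where "M = m * q"
  define a where "a = n div M"
  have n: "n = a * M + t" by (simp only: a_def t_def M_def div_mult_mod_eq)
  have Mq: "2 * q \<le> M" using m by (simp add: M_def)
  have t: "t < M" using Mq q by (simp add: t_def M_def)
  have digit: "(b * M + u) div q mod m = m - 1 \<longleftrightarrow> M - q \<le> u" if "u < M" for b u
  proof -
    have "b * M + u = u + q * (m * b)" by (simp add: M_def algebra_simps)
    then have "(b * M + u) div q mod m = (m * b + u div q) mod m"
      using q by (simp only: div_mult_self2)
    also have "\<dots> = u div q"
      using that by (simp add: M_def less_mult_imp_div_less)
    finally have *: "(b * M + u) div q mod m = u div q" .
    have "u div q < m" using that by (simp add: M_def less_mult_imp_div_less)
    then have "u div q = m - 1 \<longleftrightarrow> m - 1 \<le> u div q" by auto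
    also have "\<dots> \<longleftrightarrow> (m - 1) * q \<le> u" using q by (simp add: less_eq_div_iff_mult_less_eq)
    finally show ?thesis using * by (simp add: M_def diff_mult_distrib)
  qed
  \<comment> \<open>For \<open>t < q\<close> the truncated \<open>t - q\<close> is 0, so the
    interval then begins at the start of the block.\<close>
  have "{v. v < n \<and> n \<le> v + q \<and> v div q mod m \<noteq> m - 1}
    = {a * M + (t - q)..<a * M + min t (M - q)}" (is "?A = ?B")
  proof (intro equalityI subsetI)
    fix v assume v: "v \<in> ?A"
    show "v \<in> ?B"
    proof (cases "a * M \<le> v")
      case True
      then obtain u where u: "v = a * M + u" using le_Suc_ex by blast
      then have "u < t" "t \<le> u + q" using v n by auto
      then show ?thesis using v u t digit[of u a] by auto
    next
      case False
      \<comment> \<open>From an earlier block, \<open>n <= v + q\<close> can hold only in the last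
        \<open>q\<close> places of block \<open>a - 1\<close>, where the digit is
        \<open>m - 1\<close>.\<close>
      then obtain b where b: "a = Suc b" by (cases a) auto
      have "v \<ge> b * M" using False v n Mq b by auto
      then obtain u where u: "v = b * M + u" using le_Suc_ex by blast
      then have "u < M" "M - q \<le> u" using False v n b by auto
      then show ?thesis using v u digit[of u b] by auto
    qed
  next
    fix v assume v: "v \<in> ?B"
    then obtain u where u: "v = a * M + u" using le_Suc_ex[of "a * M" v] by auto
    then show "v \<in> ?A" using v t n digit[of u a] by auto
  qed
  then show ?thesis using t Mq by (auto simp flip: M_def)
qed

lemma card_boundary_direction:
  assumes m: "m \<ge> 2" and i: "i \<in> {1..r}" and n: "n \<le> m ^ r"
  defines "t \<equiv> n mod m ^ Suc (r - i)"
  shows "card {x \<in> digit_vectors m r. digit_value m r x < n \<and>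
      \<not> digit_value m r (x(i := Suc (x i) mod m)) < n}
    = min (min t (m ^ Suc (r - i) - t)) (m ^ (r - i))" (is "card ?X = _")
proof -
  let ?D = "digit_vectors m r" and ?v = "digit_value m r"
  define q where "q = m ^ (r - i)"
  have q: "q > 0" using m by (simp add: q_def)
  have vbij: "bij_betw ?v ?D {..<m ^ r}" by (rule bij_betw_digit_value[OF m])
  \<comment> \<open>A digit \<open>m - 1\<close> wraps around to 0, which lowers the value and so
    cannot leave the segment; any other digit raises the value by exactly \<open>q\<close>.\<close>
  have *: "\<not> ?v (x(i := Suc (x i) mod m)) < n \<longleftrightarrow> n \<le> ?v x + q \<and> ?v x div q mod m \<noteq> m - 1"
    if x: "x \<in> ?D" "?v x < n" for x
  proof -
    have dig: "?v x div q mod m = x i"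
      unfolding q_def using digit_vectors_less[OF m] x i by (intro digit_value_digit) auto
    have lt: "x i < m" using digit_vectors_less[OF m] x i by auto
    have upd: "?v (x(i := d)) + x i * q = ?v x + d * q" for d
      unfolding q_def by (rule digit_value_upd[OF i])
    show ?thesis
    proof (cases "x i = m - 1")
      case True
      then have "Suc (x i) mod m = 0" using m by simp
      then show ?thesis using upd[of 0] x True dig by simp
    next
      case False
      then have "Suc (x i) mod m = Suc (x i)" using lt by simp
      then show ?thesis using upd[of "Suc (x i)"] False dig by auto
    qed
  qed
  have "card ?X = card (?v ` ?X)"
    using inj_on_subset[OF bij_betw_imp_inj_on[OF vbij]] by (subst card_image) auto
  also have "?v ` ?X = {v. v < n \<and> n \<le> v + q \<and> v div q mod m \<noteq> m - 1}" (is "_ = ?V")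
  proof -
    have "?X = {x \<in> ?D. ?v x \<in> ?V}" using * by auto
    \<comment> \<open>Since \<open>n <= m ^ r\<close>, every number below \<open>n\<close> is the
      value of some digit vector.\<close>
    moreover have "?V \<subseteq> ?v ` ?D" using vbij n by (auto simp: bij_betw_def)
    ultimately show ?thesis by blast
  qed
  also have "card ?V = min (min t (m * q - t)) q"
    using card_range_digit_ne[OF m q] by (simp add: t_def q_def)
  finally show ?thesis by (simp only: q_def power_Suc)
qed

lemma edge_boundary_eq_sum:
  assumes "finite S" "finite A"
  shows "edge_boundary G S A = (\<Sum>g\<in>S. card {a \<in> A. a \<otimes>\<^bsub>G\<^esub> g \<notin> A})"
proof -
  \<comment> \<open>Swapping the components groups the pairs by generator, so that the cardinality
    becomes a sum over \<open>S\<close>.\<close>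
  have "{(a, g) \<in> A \<times> S. a \<otimes>\<^bsub>G\<^esub> g \<notin> A}
      = prod.swap ` (SIGMA g:S. {a \<in> A. a \<otimes>\<^bsub>G\<^esub> g \<notin> A})"
    by (auto simp: image_iff)
  then show ?thesis
    unfolding edge_boundary_def using assms by (simp add: card_image)
qed

section \<open>The generalized Takagi function at multiples of \<open>1 / m ^ r\<close>\<close>

lemma dist_nearest_int_divide:
  fixes n M :: nat
  assumes "M > 0"
  shows "real M * dist_nearest_int (real n / real M) = real (min (n mod M) (M - n mod M))"
proof -
  define a t where "a = n div M" and "t = n mod M"
  have n: "n = a * M + t" by (simp add: a_def t_def)
  have t: "t < M" using assms by (simp add: t_def)
  have x: "real n / real M = real a + real t / real M"
    using assms by (simp add: n add_divide_distrib)
  show ?thesis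
  proof (cases "2 * t < M")
    case True
    have "round (real n / real M) = int a"
      unfolding x using True by (intro round_unique) (auto simp: field_simps)
    then have "dist_nearest_int (real n / real M) = real t / real M"
      by (simp add: dist_nearest_int_def x)
    then show ?thesis using True assms by (simp flip: t_def)
  next
    case False
    \<comment> \<open>The tie \<open>2 * t = M\<close> belongs to this case, since
      \<open>round\<close> sends halves upwards.\<close>
    have "round (real n / real M) = int a + 1"
      unfolding x using False t by (intro round_unique) (auto simp: field_simps)
    then have "dist_nearest_int (real n / real M) = 1 - real t / real M"
      using t by (simp add: dist_nearest_int_def x)
    then show ?thesis using False t assms by (simp add: field_simps of_nat_diff flip: t_def)
  qed
qed

text \<open>With \<open>M = m ^ Suc (r - i)\<close>, the summand of index \<open>i - 1\<close> has
  argument \<open>n / M\<close>, and \<open>m ^ r\<close> divided by its denominator is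
  \<open>M\<close>. Scaling by \<open>M\<close> turns the distance into
  \<open>min (n mod M) (M - n mod M)\<close> and the cutoff \<open>1 / m\<close> into
  \<open>m ^ (r - i)\<close>.\<close>

lemma takagi_rational_eq_sum:
  fixes m r n :: nat
  assumes m: "m \<ge> 2"
  shows "real m ^ r * takagi m (real n / real m ^ r)
    = (\<Sum>i\<in>{1..r}. real (min (min (n mod m ^ Suc (r - i)) (m ^ Suc (r - i) - n mod m ^ Suc (r - i)))
        (m ^ (r - i))))"
proof -
  let ?f = "\<lambda>k. trunc_dist_nearest_int (1 / real m) (real m ^ k * (real n / real m ^ r)) / real m ^ k"
  \<comment> \<open>From index \<open>r\<close> on the argument is an integer, so its distance to
    the nearest integer is 0 and the series becomes a finite sum.\<close>
  have "?f k = 0" if "k \<ge> r" for k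
  proof -
    obtain d where "k = r + d" using \<open>k \<ge> r\<close> le_Suc_ex by blast
    then have "real m ^ k * (real n / real m ^ r) = real_of_int (int (m ^ d * n))"
      using m by (simp add: power_add)
    then have "dist_nearest_int (real m ^ k * (real n / real m ^ r)) = 0"
      unfolding dist_nearest_int_def by (metis abs_zero diff_self round_of_int)
    then show ?thesis by (simp add: trunc_dist_nearest_int_def)
  qed
  then have "takagi m (real n / real m ^ r) = (\<Sum>k<r. ?f k)"
    unfolding takagi_def by (intro suminf_finite) auto
  also have "\<dots> = (\<Sum>i\<in>{1..r}. ?f (i - 1))"
    by (rule sum.reindex_bij_witness[of _ "\<lambda>i. i - 1" Suc]) auto
  finally have "real m ^ r * takagi m (real n / real m ^ r) = (\<Sum>i\<in>{1..r}. real m ^ r * ?f (i - 1))"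
    by (simp only: sum_distrib_left)
  also have "\<dots> = (\<Sum>i\<in>{1..r}.
      real (min (min (n mod m ^ Suc (r - i)) (m ^ Suc (r - i) - n mod m ^ Suc (r - i))) (m ^ (r - i))))"
  proof (rule sum.cong[OF refl])
    fix i assume i: "i \<in> {1..r}"
    define M where "M = m ^ Suc (r - i)"
    have M: "M > 0" using m by (simp add: M_def)
    have "r = (i - 1) + Suc (r - i)" using i by auto
    then have mr: "real m ^ r = real m ^ (i - 1) * real M"
      by (metis M_def of_nat_power power_add)
    have "real m ^ r * ?f (i - 1) = real M * trunc_dist_nearest_int (1 / real m) (real n / real M)"
      unfolding mr using m by simp
    also have "\<dots> = min (real M * dist_nearest_int (real n / real M)) (real M * (1 / real m))"
      using M by (simp add: trunc_dist_nearest_int_def min_mult_distrib_left)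
    also have "real M * (1 / real m) = real (m ^ (r - i))"
      using m by (simp add: M_def)
    finally show "real m ^ r * ?f (i - 1) = real (min (min (n mod m ^ Suc (r - i))
        (m ^ Suc (r - i) - n mod m ^ Suc (r - i))) (m ^ (r - i)))"
      unfolding dist_nearest_int_divide[OF M] by (simp only: M_def of_nat_min)
  qed
  finally show ?thesis .
qed

section \<open>Summing the boundary over the generators\<close>

theorem theorem2:
  fixes G :: "('a, 'b) monoid_scheme" and S :: "'a set" and s :: "nat \<Rightarrow> 'a"
    and m r n :: nat
  assumes "r \<ge> 1" and "m \<ge> 2"
    and "homocyclic_group G m r"
    and "S \<subseteq> carrier G" and "card S = r" and "generate G S = carrier G"
    and "bij_betw s {1..r} S"
    and "n \<le> m ^ r"
  shows "real (edge_boundary G S (initial_segment G m r s n))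
           = real m ^ r * takagi m (real n / real m ^ r)"
proof -
  let ?c = "digit_comb G r s" and ?D = "digit_vectors m r" and ?v = "digit_value m r"
  note ctx = assms(3,2,4,6,7)
  define I where "I = initial_segment G m r s n"
  have I: "I = ?c ` {x \<in> ?D. ?v x < n}"
    unfolding I_def by (rule initial_segment_digit_value[OF ctx])
  have inj: "inj_on ?c ?D" using bij_betw_digit_comb[OF ctx] by (simp add: bij_betw_def)
  have finD: "finite ?D" by (auto simp: digit_vectors_def intro: finite_PiE)
  have sG: "s i \<in> carrier G" if "i \<in> {1..r}" for i
    using that assms by (auto simp: bij_betw_def)
  have step: "card {a \<in> I. a \<otimes>\<^bsub>G\<^esub> s i \<notin> I} =
      card {x \<in> ?D. ?v x < n \<and> \<not> ?v (x(i := Suc (x i) mod m)) < n}" (is "card ?A = card ?X")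
    if i: "i \<in> {1..r}" for i
  proof -
    \<comment> \<open>The incremented vector must again be a digit vector, because membership in
      \<open>I\<close> can be read off the value only where \<open>?c\<close> is injective.\<close>
    have upd: "x(i := Suc (x i) mod m) \<in> ?D" if "x \<in> ?D" for x
    proof -
      have "Suc (x i) mod m < m" using assms(2) by simp
      then have "Suc (x i) mod m \<in> {0..m - 1}" by simp
      then show ?thesis
        using that i by (auto simp: digit_vectors_def PiE_def extensional_def)
    qed
    have mem: "?c y \<in> I \<longleftrightarrow> ?v y < n" if "y \<in> ?D" for y
      using that inj by (auto simp: I inj_on_def)
    have mult: "?c x \<otimes>\<^bsub>G\<^esub> s i = ?c (x(i := Suc (x i) mod m))" for x
      by (rule digit_comb_mult_generator[OF assms(3,2) sG i])
    have "?c x \<otimes>\<^bsub>G\<^esub> s i \<in> I \<longleftrightarrow> ?v (x(i := Suc (x i) mod m)) < n" if "x \<in> ?D" for x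
      unfolding mult using mem[OF upd[OF that]] .
    then have "?A = ?c ` ?X"
      using mem by (subst (1) I) blast
    then show ?thesis
      by (simp add: card_image inj_on_subset[OF inj])
  qed
  have "finite S" using assms(7) bij_betw_finite by blast
  moreover have "finite I" unfolding I using finD by simp
  ultimately have "edge_boundary G S I = (\<Sum>g\<in>S. card {a \<in> I. a \<otimes>\<^bsub>G\<^esub> g \<notin> I})"
    by (rule edge_boundary_eq_sum)
  \<comment> \<open>Indexing the generators by position matches direction \<open>i\<close> with the
    summand of index \<open>i - 1\<close> of the series.\<close>
  also have "\<dots> = (\<Sum>i\<in>{1..r}. card {a \<in> I. a \<otimes>\<^bsub>G\<^esub> s i \<notin> I})"
    by (rule sum.reindex_bij_betw[OF assms(7), symmetric])
  also have "\<dots> = (\<Sum>i\<in>{1..r}. min (min (n mod m ^ Suc (r - i))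
      (m ^ Suc (r - i) - n mod m ^ Suc (r - i))) (m ^ (r - i)))"
    using step card_boundary_direction[OF assms(2) _ assms(8)] by (intro sum.cong) auto
  finally show ?thesis
    unfolding takagi_rational_eq_sum[OF assms(2)] I_def by (simp only: of_nat_sum)
qed

end
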